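(* Let $A$ be a closed densely defined symmetric operator with equal deficiency indices in a separable Hilbert space $\mathfrak H$, and let $M(z)$ be the Weyl function of $A$ corresponding to a boundary triplet $\{\mathcal H,\Gamma_0,\Gamma_1\}$ for $A^*$. Then $M(z)$ belongs to the class $(R)$.
   Context: $[\mathcal H]$ denotes the bounded everywhere defined operators on $\mathcal H$, and $\operatorname{Im}T=(T-T^* )/2i$ for $T\in[\mathcal H]$. A boundary triplet for $A^*$ is a triple $\{\mathcal H,\Gamma_0,\Gamma_1\}$, where $\mathcal H$ is a Hilbert space and $\Gamma_0,\Gamma_1:\operatorname{dom}(A^* )\to\mathcal H$ are linear maps such that (i) $(A^*f,g)_{\mathfrak H}-(f,A^*g)_{\mathfrak H}=(\Gamma_1f,\Gamma_0g)_{\mathcal H}-(\Gamma_0f,\Gamma_1g)_{\mathcal H}$ for all $f,g\in\operatorname{dom}(A^* )$, and (ii) $f\mapsto(\Gamma_1f,\Gamma_0f)$ maps $\operatorname{dom}(A^* )$ onto $\mathcal H\oplus\mathcal H$. Put $A_0=A^*|_{\ker\Gamma_0}$ (self-adjoint) and $\mathfrak N_z=\ker(A^*-z)$. The Weyl function is the $[\mathcal H]$-valued function $M(z)$ on $\rho(A_0)$ defined by $M(z)\Gamma_0f_z=\Gamma_1f_z$, $f_z\in\mathfrak N_z$. The class $(R)$ consists of the functions $F$ that are holomorphic in the open upper half-plane $\mathbb C_+$ with values in $[\mathcal H]$ and satisfy $\operatorname{Im}F(z)\ge0$ for $z\in\mathbb C_+$. *)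

theory Defs
  imports "HOL-Analysis.Analysis"
begin

text \<open>The form \<open>cinner\<close> is linear in the first argument. The real inner product and the
  norm of the base class are those of the underlying real space, so that
  \<open>(norm x)\<^sup>2 = Re (cinner x x) = cinner x x\<close>.\<close>

class complex_inner = real_inner +
  fixes scaleC :: "complex \<Rightarrow> 'a \<Rightarrow> 'a" (infixr \<open>*\<^sub>C\<close> 75)
    and cinner :: "'a \<Rightarrow> 'a \<Rightarrow> complex"
  assumes scaleC_of_real: "complex_of_real r *\<^sub>C x = r *\<^sub>R x"
    and scaleC_add_right: "a *\<^sub>C (x + y) = a *\<^sub>C x + a *\<^sub>C y"
    and scaleC_add_left: "(a + b) *\<^sub>C x = a *\<^sub>C x + b *\<^sub>C x"
    and scaleC_scaleC: "a *\<^sub>C b *\<^sub>C x = (a * b) *\<^sub>C x"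
    and cinner_commute: "cinner x y = cnj (cinner y x)"
    and cinner_add_left: "cinner (x + y) z = cinner x z + cinner y z"
    and cinner_scaleC_left: "cinner (a *\<^sub>C x) y = a * cinner x y"
    and inner_eq_Re_cinner: "inner x y = Re (cinner x y)"

class chilbert_space = complex_inner + complete_space

instantiation complex :: chilbert_space
begin

definition scaleC_complex :: "complex \<Rightarrow> complex \<Rightarrow> complex"
  where "scaleC_complex a x = a * x"

definition cinner_complex :: "complex \<Rightarrow> complex \<Rightarrow> complex"
  where "cinner_complex x y = x * cnj y"

instance
  by standard
    (auto simp: scaleC_complex_def cinner_complex_def inner_complex_def algebra_simps scaleR_conv_of_real)

end

global_interpretation complex_vector:
  vector_space "scaleC :: complex \<Rightarrow> 'a \<Rightarrow> 'a::complex_inner"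
proof
  show "1 *\<^sub>C x = x" for x :: 'a
    using scaleC_of_real[of 1 x] by simp
qed (simp_all add: scaleC_add_right scaleC_add_left scaleC_scaleC)

text \<open>The Hilbert space dimension of a closed subspace is the cardinality of any of its orthonormal
  bases, so two dimensions agree iff there are equipotent bases.\<close>

definition orthonormal_basis :: "'a::complex_inner set \<Rightarrow> 'a set \<Rightarrow> bool"
  where "orthonormal_basis B S \<longleftrightarrow>
    B \<subseteq> S \<and>
    (\<forall>x\<in>B. \<forall>y\<in>B. cinner x y = (if x = y then 1 else 0)) \<and>
    S \<subseteq> closure (complex_vector.span B)"

definition same_hilbert_dim :: "'a::complex_inner set \<Rightarrow> 'b::complex_inner set \<Rightarrow> bool"
  where "same_hilbert_dim S T \<longleftrightarrow>
    (\<exists>B C. orthonormal_basis B S \<and> orthonormal_basis C T \<and> B \<approx> C)"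

definition bounded_op :: "('a::complex_inner \<Rightarrow> 'b::complex_inner) \<Rightarrow> bool"
  where "bounded_op T \<longleftrightarrow> bounded_linear T \<and> (\<forall>c x. T (c *\<^sub>C x) = c *\<^sub>C T x)"

definition op_adjoint :: "('a::complex_inner \<Rightarrow> 'a) \<Rightarrow> 'a \<Rightarrow> 'a"
  where "op_adjoint T y = (THE h. \<forall>x. cinner (T x) y = cinner x h)"

definition op_Im :: "('a::complex_inner \<Rightarrow> 'a) \<Rightarrow> 'a \<Rightarrow> 'a"
  where "op_Im T x = (1 / (2 * \<i>)) *\<^sub>C (T x - op_adjoint T x)"

definition op_nonneg :: "('a::complex_inner \<Rightarrow> 'a) \<Rightarrow> bool"
  where "op_nonneg T \<longleftrightarrow> (\<forall>x. cinner (T x) x \<in> \<real>\<^sub>\<ge>\<^sub>0)"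

definition op_holomorphic_on ::
    "(complex \<Rightarrow> 'a::complex_inner \<Rightarrow> 'b::complex_inner) \<Rightarrow> complex set \<Rightarrow> bool"
  where "op_holomorphic_on F S \<longleftrightarrow>
    (\<forall>z\<in>S. bounded_op (F z)) \<and>
    (\<forall>z\<in>S. \<exists>D. bounded_op D \<and>
      ((\<lambda>w. onorm (\<lambda>x. (1 / (w - z)) *\<^sub>C (F w x - F z x) - D x)) \<longlongrightarrow> 0) (at z within S))"

definition upper_half_plane :: "complex set"
  where "upper_half_plane = {z. Im z > 0}"

definition class_R :: "(complex \<Rightarrow> 'a::complex_inner \<Rightarrow> 'a) \<Rightarrow> bool"
  where "class_R F \<longleftrightarrow>
    op_holomorphic_on F upper_half_plane \<and>
    (\<forall>z\<in>upper_half_plane. op_nonneg (op_Im (F z)))"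

text \<open>An operator in a Hilbert space, defined on a linear subspace only, is a partial map.\<close>

definition linear_op :: "('a::complex_inner \<rightharpoonup> 'a) \<Rightarrow> bool"
  where "linear_op A \<longleftrightarrow>
    complex_vector.subspace (dom A) \<and>
    (\<forall>x\<in>dom A. \<forall>y\<in>dom A. the (A (x + y)) = the (A x) + the (A y)) \<and>
    (\<forall>c. \<forall>x\<in>dom A. the (A (c *\<^sub>C x)) = c *\<^sub>C the (A x))"

definition densely_defined :: "('a::complex_inner \<rightharpoonup> 'a) \<Rightarrow> bool"
  where "densely_defined A \<longleftrightarrow> closure (dom A) = UNIV"

definition closed_op :: "('a::complex_inner \<rightharpoonup> 'a) \<Rightarrow> bool"
  where "closed_op A \<longleftrightarrow> closed {(x, the (A x)) | x. x \<in> dom A}"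

definition symmetric_op :: "('a::complex_inner \<rightharpoonup> 'a) \<Rightarrow> bool"
  where "symmetric_op A \<longleftrightarrow>
    (\<forall>x\<in>dom A. \<forall>y\<in>dom A. cinner (the (A x)) y = cinner x (the (A y)))"

text \<open>The vector \<open>h\<close> below is unique if \<open>A\<close> is densely defined.\<close>

definition adj :: "('a::complex_inner \<rightharpoonup> 'a) \<Rightarrow> ('a \<rightharpoonup> 'a)"
  where "adj A g =
    (if \<exists>h. \<forall>f\<in>dom A. cinner (the (A f)) g = cinner f h
     then Some (THE h. \<forall>f\<in>dom A. cinner (the (A f)) g = cinner f h)
     else None)"

definition eigenspace :: "('a::complex_inner \<rightharpoonup> 'a) \<Rightarrow> complex \<Rightarrow> 'a set"
  where "eigenspace T z = {f \<in> dom T. the (T f) - z *\<^sub>C f = 0}"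

definition equal_deficiency_indices :: "('a::complex_inner \<rightharpoonup> 'a) \<Rightarrow> bool"
  where "equal_deficiency_indices A \<longleftrightarrow>
    same_hilbert_dim (eigenspace (adj A) \<i>) (eigenspace (adj A) (- \<i>))"

text \<open>The last conjunct is boundedness of \<open>(T - z)\<^sup>-\<^sup>1\<close>.\<close>

definition resolvent_set :: "('a::complex_inner \<rightharpoonup> 'a) \<Rightarrow> complex set"
  where "resolvent_set T =
    {z. bij_betw (\<lambda>x. the (T x) - z *\<^sub>C x) (dom T) UNIV \<and>
        (\<exists>C. \<forall>x\<in>dom T. norm x \<le> C * norm (the (T x) - z *\<^sub>C x))}"

text \<open>The maps \<open>\<Gamma>\<^sub>0\<close>, \<open>\<Gamma>\<^sub>1\<close> are total functions, but only their values on the domain of the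
  adjoint matter.\<close>

definition linear_on_set ::
    "'a::complex_inner set \<Rightarrow> ('a \<Rightarrow> 'b::complex_inner) \<Rightarrow> bool"
  where "linear_on_set S G \<longleftrightarrow>
    (\<forall>x\<in>S. \<forall>y\<in>S. G (x + y) = G x + G y) \<and>
    (\<forall>c. \<forall>x\<in>S. G (c *\<^sub>C x) = c *\<^sub>C G x)"

definition boundary_triplet ::
    "('a::complex_inner \<rightharpoonup> 'a) \<Rightarrow> ('a \<Rightarrow> 'b::chilbert_space) \<Rightarrow> ('a \<Rightarrow> 'b) \<Rightarrow> bool"
  where "boundary_triplet A \<Gamma>\<^sub>0 \<Gamma>\<^sub>1 \<longleftrightarrow>
    linear_on_set (dom (adj A)) \<Gamma>\<^sub>0 \<and>
    linear_on_set (dom (adj A)) \<Gamma>\<^sub>1 \<and>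
    (\<forall>f\<in>dom (adj A). \<forall>g\<in>dom (adj A).
      cinner (the (adj A f)) g - cinner f (the (adj A g)) =
      cinner (\<Gamma>\<^sub>1 f) (\<Gamma>\<^sub>0 g) - cinner (\<Gamma>\<^sub>0 f) (\<Gamma>\<^sub>1 g)) \<and>
    (\<lambda>f. (\<Gamma>\<^sub>1 f, \<Gamma>\<^sub>0 f)) ` dom (adj A) = UNIV"

definition op_A0 :: "('a::complex_inner \<rightharpoonup> 'a) \<Rightarrow> ('a \<Rightarrow> 'b::complex_inner) \<Rightarrow> ('a \<rightharpoonup> 'a)"
  where "op_A0 A \<Gamma>\<^sub>0 = adj A |` {f \<in> dom (adj A). \<Gamma>\<^sub>0 f = 0}"

text \<open>The Weyl function takes the value \<open>undefined\<close> outside the resolvent set of \<open>A\<^sub>0\<close>.\<close>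

definition weyl_function ::
    "('a::complex_inner \<rightharpoonup> 'a) \<Rightarrow> ('a \<Rightarrow> 'b::complex_inner) \<Rightarrow> ('a \<Rightarrow> 'b) \<Rightarrow> complex \<Rightarrow> 'b \<Rightarrow> 'b"
  where "weyl_function A \<Gamma>\<^sub>0 \<Gamma>\<^sub>1 =
    (\<lambda>z\<in>resolvent_set (op_A0 A \<Gamma>\<^sub>0).
      THE T. bounded_op T \<and> (\<forall>f\<in>eigenspace (adj A) z. T (\<Gamma>\<^sub>0 f) = \<Gamma>\<^sub>1 f))"

end

(* Green's identity shows that A_0 is self-adjoint, so its resolvent R(z) exists for every non-real z.
   Decomposing along dom A_0 + N_z, for each a there is a unique f = gamma(z) a in N_z with
   Gamma_0 f = a, and M(z) a = Gamma_1 (gamma(z) a). Green's identity on eigenvectors gives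
     (M(w) a, b) - (a, M(z) b) = (w - cnj z) (gamma(w) a, gamma(z) b).
   Hence M(z) has the everywhere defined adjoint M(cnj z), so it is bounded by Hellinger--Toeplitz,
   and Im (M(z) a, a) = Im z |gamma(z) a|^2. In the same way gamma(z) and Gamma_1 R(cnj z) are
   adjoint to each other, hence bounded. Finally
     (M(w) - M(z)) / (w - z) - Gamma_1 R(z) gamma(z) = (w - z) Gamma_1 R(z) R(w) gamma(z),
   whose norm tends to 0 as w tends to z because |R(w)| <= 1 / |Im w|. *)

theory Submission
  imports Defs
begin

section \<open>Complex inner product spaces\<close>

lemma cinner_add_right: "cinner x (y + z) = cinner x y + cinner x z"
  by (metis cinner_add_left cinner_commute complex_cnj_add)

lemma cinner_scaleC_right: "cinner x (a *\<^sub>C y) = cnj a * cinner x y"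
  by (metis cinner_scaleC_left cinner_commute complex_cnj_mult)

lemma scaleC_minus_one: "(-1) *\<^sub>C x = - (x :: 'a::complex_inner)"
  using scaleC_of_real[of "-1" x] by simp

lemma cinner_minus_left: "cinner (- x) y = - cinner x y"
  by (metis cinner_scaleC_left scaleC_minus_one mult_minus1)

lemma cinner_minus_right: "cinner x (- y) = - cinner x y"
  by (metis cinner_minus_left cinner_commute complex_cnj_minus)

lemma cinner_diff_left: "cinner (x - y) z = cinner x z - cinner y z"
  by (metis cinner_add_left cinner_minus_left diff_conv_add_uminus)

lemma cinner_diff_right: "cinner x (y - z) = cinner x y - cinner x z"
  by (metis cinner_add_right cinner_minus_right diff_conv_add_uminus)

lemma cinner_zero_left [simp]: "cinner 0 y = 0"
  using cinner_diff_left[of 0 0 y] by simp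

lemma cinner_zero_right [simp]: "cinner x 0 = 0"
  using cinner_diff_right[of x 0 0] by simp

lemmas cinner_simps =
  cinner_add_left cinner_add_right cinner_diff_left cinner_diff_right
  cinner_scaleC_left cinner_scaleC_right

lemma cinner_self: "cinner x x = complex_of_real ((norm x)\<^sup>2)"
proof -
  have "Im (cinner x x) = 0"
    using cinner_commute[of x x] by (metis Reals_cnj_iff complex_is_Real_iff)
  then show ?thesis
    by (simp add: complex_eq_iff power2_norm_eq_inner inner_eq_Re_cinner)
qed

lemma norm_cinner_self: "cmod (cinner x x) = norm x * norm x"
  unfolding cinner_self norm_of_real by (simp add: power2_eq_square)

text \<open>The class ties the norm to real scalars only; homogeneity over the complex field comes
  from expanding both squares with \<open>cinner_self\<close>.\<close>

lemma norm_scaleC: "norm (a *\<^sub>C x) = cmod a * norm (x :: 'a::complex_inner)"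
proof -
  have "complex_of_real ((norm (a *\<^sub>C x))\<^sup>2) = complex_of_real ((cmod a * norm x)\<^sup>2)"
    using cinner_self[of "a *\<^sub>C x"] cinner_self[of x] complex_norm_square[of a]
    by (simp add: cinner_scaleC_left cinner_scaleC_right power_mult_distrib mult.left_commute
        flip: mult.assoc)
  then show ?thesis
    by (metis of_real_eq_iff mult_nonneg_nonneg norm_ge_zero power2_eq_imp_eq)
qed

text \<open>Cauchy-Schwarz for the real inner product suffices once \<open>x\<close> is multiplied
  by the conjugate of \<open>cinner x y\<close>, which makes the product real and
  nonnegative.\<close>

lemma norm_cinner_le: "cmod (cinner x y) \<le> norm x * norm y"
proof (cases "cinner x y = 0")
  case False
  let ?c = "cinner x y"
  have "(cmod ?c)\<^sup>2 = Re (cinner (cnj ?c *\<^sub>C x) y)"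
    by (simp add: cinner_scaleC_left cmod_power2) (simp add: power2_eq_square)
  also have "\<dots> \<le> norm (cnj ?c *\<^sub>C x) * norm y"
    by (metis inner_eq_Re_cinner norm_cauchy_schwarz)
  also have "\<dots> = cmod ?c * (norm x * norm y)"
    by (simp add: norm_scaleC)
  finally show ?thesis
    using False by (simp add: power2_eq_square)
qed simp

lemma bounded_linear_cinner_right: "bounded_linear (\<lambda>y. cinner x y)"
proof (rule bounded_linear_intro[where K = "norm x"])
  show "cinner x (r *\<^sub>R y) = r *\<^sub>R cinner x y" for r y
    by (simp add: cinner_scaleC_right scaleR_conv_of_real flip: scaleC_of_real)
qed (use norm_cinner_le[of x] in \<open>simp_all add: cinner_add_right mult.commute\<close>)

lemmas tendsto_cinner_right [tendsto_intros] =
  bounded_linear.tendsto[OF bounded_linear_cinner_right]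

lemma bounded_linear_scaleC_right: "bounded_linear (\<lambda>x :: 'a::complex_inner. a *\<^sub>C x)"
proof (rule bounded_linear_intro[where K = "cmod a"])
  show "a *\<^sub>C (r *\<^sub>R x) = r *\<^sub>R a *\<^sub>C x" for r and x :: 'a
    by (simp add: scaleC_scaleC mult.commute flip: scaleC_of_real)
qed (simp_all add: scaleC_add_right norm_scaleC mult.commute)

lemmas tendsto_scaleC_right [tendsto_intros] =
  bounded_linear.tendsto[OF bounded_linear_scaleC_right]

lemma bounded_opI:
  assumes "\<And>x y. T (x + y) = T x + T y" "\<And>c x. T (c *\<^sub>C x) = c *\<^sub>C T x"
    and "\<And>x. norm (T x) \<le> norm x * K"
  shows "bounded_op T"
  unfolding bounded_op_def
  by (auto intro!: bounded_linear_intro[where K = K] simp: assms simp flip: scaleC_of_real)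

text \<open>The real hyperplane orthogonal to \<open>h\<close> is closed, so it contains the closure
  of \<open>X\<close> and thus \<open>h\<close> itself. This is what makes adjoints unique.\<close>

lemma dense_orthogonal_imp_zero:
  fixes h :: "'a::complex_inner"
  assumes "closure X = UNIV" "\<And>x. x \<in> X \<Longrightarrow> cinner x h = 0"
  shows "h = 0"
proof -
  have "closed {x. inner h x = 0}"
    by (rule closed_hyperplane)
  moreover have "X \<subseteq> {x. inner h x = 0}"
    using assms(2) inner_commute[of h] by (auto simp: inner_eq_Re_cinner)
  ultimately have "closure X \<subseteq> {x. inner h x = 0}"
    by (rule closure_minimal[rotated])
  then have "inner h h = 0"
    using assms(1) by blast
  then show ?thesis
    by simp
qed

lemma cinner_extensionality:
  assumes "\<And>x. cinner x h = cinner x k"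
  shows "h = k"
  using dense_orthogonal_imp_zero[of UNIV "h - k"] assms by (simp add: cinner_diff_right)

section \<open>Nearest points and orthogonal complements\<close>

text \<open>By the parallelogram law the sets of almost nearest points have small diameter, so
  completeness yields a nearest point.\<close>

lemma exists_nearest_point:
  fixes R :: "'a::{real_inner, complete_space} set"
  assumes "closed R" "convex R" "R \<noteq> {}"
  obtains y where "y \<in> R" "dist x y = infdist x R"
proof -
  define d where "d = infdist x R"
  have d0: "0 \<le> d"
    unfolding d_def by (rule infdist_nonneg)
  \<comment> \<open>The slack is put on the squared distance, so that the parallelogram law bounds
    the squared diameter of \<open>S n\<close> by \<open>4 / real (Suc n)\<close>.\<close>
  define S where "S n = {y \<in> R. (dist x y)\<^sup>2 \<le> d\<^sup>2 + 1 / real (Suc n)}" for n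
  have closed: "closed (S n)" for n
    unfolding S_def Collect_conj_eq
    by (intro closed_Int closed_Collect_le continuous_intros) (simp add: assms(1))
  have nonempty: "S n \<noteq> {}" for n
  proof -
    have "d < sqrt (d\<^sup>2 + 1 / real (Suc n))"
      by (rule real_less_rsqrt) simp
    then obtain y where "y \<in> R" "dist x y < sqrt (d\<^sup>2 + 1 / real (Suc n))"
      using assms(3) unfolding d_def infdist_notempty[OF assms(3)]
      by (subst (asm) cINF_less_iff) auto
    moreover from this(2) have "(dist x y)\<^sup>2 \<le> d\<^sup>2 + 1 / real (Suc n)"
      by (metis less_eq_real_def real_sqrt_le_iff real_sqrt_abs abs_of_nonneg zero_le_dist)
    ultimately show ?thesis
      by (auto simp: S_def)
  qed
  have decr: "S n \<subseteq> S m" if "m \<le> n" for m n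
    using that by (auto simp: S_def frac_le intro: order_trans)
  have small: "\<exists>n. \<forall>y\<in>S n. \<forall>y'\<in>S n. dist y y' < e" if e: "e > 0" for e
  proof -
    obtain n where n: "1 / real (Suc n) < e\<^sup>2 / 4"
      using e nat_approx_posE[of "e\<^sup>2 / 4"] by (metis divide_pos_pos zero_less_numeral zero_less_power)
    have "dist y y' < e" if "y \<in> S n" "y' \<in> S n" for y y'
    proof -
      let ?m = "(1/2) *\<^sub>R y + (1/2) *\<^sub>R y'"
      have "?m \<in> R"
        using that assms(2) by (intro convexD) (auto simp: S_def)
      then have "d \<le> dist x ?m"
        unfolding d_def by (rule infdist_le)
      then have "d\<^sup>2 \<le> (dist x ?m)\<^sup>2"
        using d0 by (rule power_mono)
      \<comment> \<open>Parallelogram law for \<open>x - y\<close> and \<open>x - y'\<close>, whose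
        sum is twice \<open>x - ?m\<close>.\<close>
      moreover have "(dist y y')\<^sup>2 + 4 * (dist x ?m)\<^sup>2 = 2 * (dist x y)\<^sup>2 + 2 * (dist x y')\<^sup>2"
        by (simp add: dist_norm power2_norm_eq_inner inner_simps inner_commute algebra_simps)
      ultimately have "(dist y y')\<^sup>2 \<le> 4 / real (Suc n)"
        using that by (simp add: S_def)
      then have "(dist y y')\<^sup>2 < e\<^sup>2"
        using n by simp
      then show ?thesis
        using \<open>e > 0\<close> by (simp add: power_less_imp_less_base)
    qed
    then show ?thesis
      by blast
  qed
  obtain y where y: "\<And>n. y \<in> S n"
    using decreasing_closed_nest[of S, OF closed nonempty decr small] by blast
  have "(dist x y)\<^sup>2 \<le> d\<^sup>2"
  proof (rule field_le_epsilon)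
    fix e :: real assume "e > 0"
    then obtain n where "1 / real (Suc n) < e"
      using nat_approx_posE by blast
    then show "(dist x y)\<^sup>2 \<le> d\<^sup>2 + e"
      using y[of n] by (simp add: S_def)
  qed
  then have "dist x y \<le> d"
    using d0 power2_le_imp_le by blast
  moreover have "y \<in> R"
    using y[of 0] by (simp add: S_def)
  ultimately show ?thesis
    using that infdist_le[of y R x] by (auto simp: d_def)
qed

text \<open>Take \<open>v = x - y\<close> with \<open>y\<close> the point of \<open>R\<close>
  nearest to \<open>x\<close>: moving \<open>y\<close> along a vector of \<open>R\<close> cannot
  shorten \<open>v\<close>.\<close>

lemma exists_inner_orthogonal:
  fixes R :: "'a::{real_inner, complete_space} set"
  assumes "closed R" "subspace R" "x \<notin> R"
  obtains v where "v \<noteq> 0" "\<And>u. u \<in> R \<Longrightarrow> inner u v = 0"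
proof -
  obtain y where y: "y \<in> R" "dist x y = infdist x R"
    using exists_nearest_point[of R x] assms subspace_imp_convex subspace_0 by blast
  have "inner u (x - y) = 0" if u: "u \<in> R" for u
  proof (cases "u = 0")
    case False
    \<comment> \<open>This \<open>t\<close> minimizes the norm of
      \<open>(x - y) - t *\<^sub>R u\<close>.\<close>
    define t where "t = inner u (x - y) / (norm u)\<^sup>2"
    have "y + t *\<^sub>R u \<in> R"
      using y u assms(2) by (simp add: subspace_add subspace_scale)
    then have "norm (x - y) \<le> norm ((x - y) - t *\<^sub>R u)"
      using infdist_le[of "y + t *\<^sub>R u" R x] y by (simp add: dist_norm diff_diff_add)
    then have "(norm (x - y))\<^sup>2 \<le> (norm ((x - y) - t *\<^sub>R u))\<^sup>2"
      by (simp add: power_mono)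
    also have "\<dots> = (norm (x - y))\<^sup>2 - 2 * t * inner u (x - y) + t\<^sup>2 * (norm u)\<^sup>2"
      unfolding power2_norm_eq_inner
      by (simp add: inner_diff_left inner_diff_right inner_commute power2_eq_square algebra_simps)
    also have "\<dots> = (norm (x - y))\<^sup>2 - (inner u (x - y))\<^sup>2 / (norm u)\<^sup>2"
      using False by (simp add: t_def field_simps power2_eq_square)
    finally show ?thesis
      using False by (simp add: divide_le_0_iff)
  qed simp
  moreover have "x - y \<noteq> 0"
    using y assms(3) by auto
  ultimately show ?thesis
    using that by blast
qed

text \<open>A proper closed subspace would have a nonzero real-orthogonal vector; closure under
  multiplication by \<open>\<i>\<close> upgrades this to complex orthogonality.\<close>

lemma closed_subspace_eq_UNIV:
  fixes R :: "'a::chilbert_space set"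
  assumes closed: "closed R" and sub: "complex_vector.subspace R"
    and orth: "\<And>v. (\<And>u. u \<in> R \<Longrightarrow> cinner u v = 0) \<Longrightarrow> v = 0"
  shows "R = UNIV"
proof (rule ccontr)
  assume "R \<noteq> UNIV"
  then obtain x where x: "x \<notin> R"
    by auto
  have "subspace R"
    using sub unfolding subspace_def complex_vector.subspace_def
    by (metis scaleC_of_real)
  then obtain v where v: "v \<noteq> 0" "\<And>u. u \<in> R \<Longrightarrow> inner u v = 0"
    using exists_inner_orthogonal closed x by blast
  have "cinner u v = 0" if "u \<in> R" for u
  proof -
    have "\<i> *\<^sub>C u \<in> R"
      using that sub complex_vector.subspace_scale by blast
    \<comment> \<open>Testing with \<open>u\<close> kills the real part of
      \<open>cinner u v\<close>, testing with \<open>\<i> *\<^sub>C u\<close> the imaginary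
      part.\<close>
    then show ?thesis
      using v(2)[of u] v(2)[of "\<i> *\<^sub>C u"] that
      by (simp add: inner_eq_Re_cinner cinner_scaleC_left complex_eq_iff)
  qed
  then show False
    using orth v(1) by blast
qed

section \<open>Boundedness of everywhere defined maps that have an adjoint\<close>

text \<open>Put \<open>y = S x\<close> in the adjoint relation, apply Cauchy-Schwarz and cancel one
  factor \<open>norm (S x)\<close>.\<close>

lemma adjoint_pair_bound:
  fixes S :: "'a::complex_inner \<Rightarrow> 'b::complex_inner"
  assumes adj: "\<And>x y. cinner (S x) y = cinner x (T y)"
    and bound: "\<And>y. norm (T y) \<le> K * norm y" and "0 \<le> K"
  shows "norm (S x) \<le> K * norm x"
proof (cases "S x = 0")
  case False
  have "norm (S x) * norm (S x) = cmod (cinner x (T (S x)))"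
    by (simp add: norm_cinner_self flip: adj)
  also have "\<dots> \<le> norm x * (K * norm (S x))"
    by (intro order_trans[OF norm_cinner_le] mult_left_mono bound) simp
  finally show ?thesis
    using False by (simp add: mult.commute)
qed (use \<open>0 \<le> K\<close> in simp)

text \<open>The Hellinger--Toeplitz theorem. The set of all \<open>y\<close> with \<open>norm (T y) \<le> n\<close> is closed because it
  can be expressed by the continuous functionals \<open>y \<mapsto> cinner (S x) y\<close>, so Baire's theorem applies.\<close>

theorem adjoint_pair_bounded:
  fixes S :: "'a::complex_inner \<Rightarrow> 'b::chilbert_space"
  assumes adj: "\<And>x y. cinner (S x) y = cinner x (T y)"
  shows "bounded_op S"
proof -
  have T_diff: "T (y - y') = T y - T y'" for y y'
    by (rule cinner_extensionality) (simp add: cinner_diff_right flip: adj)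
  have T_scale: "T (c *\<^sub>C y) = c *\<^sub>C T y" for c y
    by (rule cinner_extensionality) (simp add: cinner_scaleC_right flip: adj)
  define E where "E n = {y. norm (T y) \<le> real n}" for n
  have E_eq: "E n = (\<Inter>x. {y. cmod (cinner (S x) y) \<le> norm x * real n})" for n
  proof (intro equalityI subsetI INT_I CollectI)
    fix y x assume "y \<in> E n"
    then show "cmod (cinner (S x) y) \<le> norm x * real n"
      unfolding adj E_def
      by (intro order_trans[OF norm_cinner_le] mult_left_mono) auto
  next
    fix y assume "y \<in> (\<Inter>x. {y. cmod (cinner (S x) y) \<le> norm x * real n})"
    \<comment> \<open>The functional with \<open>x = T y\<close> recovers the norm of
      \<open>T y\<close>.\<close>
    then have "cmod (cinner (T y) (T y)) \<le> norm (T y) * real n"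
      by (auto simp: adj)
    then show "y \<in> E n"
      by (cases "T y = 0") (simp_all add: E_def norm_cinner_self)
  qed
  have closed: "closed (E n)" for n
    unfolding E_eq
    by (intro closed_INT ballI closed_Collect_le continuous_intros
        bounded_linear.continuous_on[OF bounded_linear_cinner_right])
  have "\<exists>n. interior (E n) \<noteq> {}"
  proof (rule ccontr)
    assume "\<nexists>n. interior (E n) \<noteq> {}"
    \<comment> \<open>By Baire, countably many closed sets with empty interior have a union with
      empty interior, yet the sets \<open>E n\<close> cover the space.\<close>
    then have "euclidean interior_of \<Union>(range E) = {}"
      using closed by (intro Baire_category_alt) (auto simp: completely_metrizable_space_euclidean)
    moreover have "\<Union>(range E) = UNIV"
      using real_arch_simple by (auto simp: E_def)
    ultimately show False
      using interior_of_topspace[of "euclidean :: 'b topology"] by simp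
  qed
  then obtain n y0 where "y0 \<in> interior (E n)"
    by blast
  then obtain e where e: "e > 0" "ball y0 e \<subseteq> E n"
    by (auto simp: mem_interior)
  have T_bound: "norm (T y) \<le> 4 * real n / e * norm y" for y
  proof (cases "y = 0")
    case True
    then show ?thesis
      using T_diff[of 0 0] by simp
  next
    case False
    \<comment> \<open>Scaling \<open>y\<close> to norm \<open>e / 2\<close> keeps
      \<open>y0 - v\<close> in the ball. The image of \<open>v\<close> then has norm at most
      \<open>2 * real n\<close>, and dividing by \<open>r\<close> gives the constant
      \<open>4 * real n / e\<close>.\<close>
    define r where "r = e / (2 * norm y)"
    have r: "r > 0" "r * norm y = e / 2"
      using e(1) False by (simp_all add: r_def)
    define v where "v = complex_of_real r *\<^sub>C y"
    have "norm v = e / 2"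
      using r by (simp add: v_def norm_scaleC)
    then have "y0 - v \<in> E n" "y0 \<in> E n"
      using e by (auto intro!: subsetD[OF e(2)] simp: dist_norm)
    then have "norm (T y0 - T (y0 - v)) \<le> 2 * real n"
      using norm_triangle_ineq4[of "T y0" "T (y0 - v)"] by (simp add: E_def)
    then have "r * norm (T y) \<le> 2 * real n"
      using r(1) by (simp add: T_diff) (simp add: v_def T_scale norm_scaleC)
    then show ?thesis
      using e(1) False by (simp add: r_def field_simps)
  qed
  show ?thesis
  proof (rule bounded_opI)
    \<comment> \<open>Commuting both products moves \<open>S\<close> into the first slot, where
      \<open>adj\<close> applies.\<close>
    show "S (x + x') = S x + S x'" for x x'
      by (rule cinner_extensionality, subst (1 2) cinner_commute)
        (simp add: adj cinner_add_left cinner_add_right)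
    show "S (c *\<^sub>C x) = c *\<^sub>C S x" for c x
      by (rule cinner_extensionality, subst (1 2) cinner_commute)
        (simp add: adj cinner_scaleC_left cinner_scaleC_right)
    show "norm (S x) \<le> norm x * (4 * real n / e)" for x
      using adjoint_pair_bound[OF adj T_bound] e(1) by (simp add: mult.commute)
  qed
qed

section \<open>Adjoints of densely defined operators\<close>

text \<open>Two candidates for \<open>h\<close> differ by a vector orthogonal to the dense domain,
  so the description in \<open>adj\<close> is determined.\<close>

lemma adj_eq_Some_iff:
  assumes "densely_defined A"
  shows "adj A g = Some h \<longleftrightarrow> (\<forall>f\<in>dom A. cinner (the (A f)) g = cinner f h)"
proof -
  let ?P = "\<lambda>h. \<forall>f\<in>dom A. cinner (the (A f)) g = cinner f h"
  have unique: "k = h" if "?P h" "?P k" for h k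
    using dense_orthogonal_imp_zero[of "dom A" "k - h"] that assms
    by (auto simp: densely_defined_def cinner_diff_right)
  show ?thesis
  proof (cases "\<exists>h. ?P h")
    case True
    then obtain k where k: "?P k"
      by blast
    then have "(THE h. ?P h) = k"
      by (intro the_equality unique)
    moreover have "adj A g = Some (THE h. ?P h)"
      unfolding adj_def using True by (rule if_P)
    ultimately have "adj A g = Some k"
      by simp
    then show ?thesis
      using unique[OF k] k by (metis option.inject)
  next
    case False
    then have "adj A g = None"
      unfolding adj_def by (rule if_not_P)
    then show ?thesis
      using False by auto
  qed
qed

lemma adjI:
  assumes "densely_defined A" "\<And>f. f \<in> dom A \<Longrightarrow> cinner (the (A f)) g = cinner f h"
  shows "g \<in> dom (adj A)" "the (adj A g) = h"
proof -
  have "adj A g = Some h"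
    using assms adj_eq_Some_iff by blast
  then show "g \<in> dom (adj A)" "the (adj A g) = h"
    by auto
qed

lemma adjD:
  assumes "densely_defined A" "g \<in> dom (adj A)" "f \<in> dom A"
  shows "cinner (the (A f)) g = cinner f (the (adj A g))"
  using assms adj_eq_Some_iff by fastforce

lemma adj_add:
  assumes "densely_defined A" "f \<in> dom (adj A)" "g \<in> dom (adj A)"
  shows "f + g \<in> dom (adj A)" "the (adj A (f + g)) = the (adj A f) + the (adj A g)"
proof -
  have *: "cinner (the (A u)) (f + g) = cinner u (the (adj A f) + the (adj A g))" if "u \<in> dom A" for u
    using that assms by (simp add: adjD cinner_add_right del: domIff)
  show "f + g \<in> dom (adj A)" "the (adj A (f + g)) = the (adj A f) + the (adj A g)"
    by (rule adjI[OF assms(1)], erule *)+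
qed

lemma adj_scaleC:
  assumes "densely_defined A" "f \<in> dom (adj A)"
  shows "c *\<^sub>C f \<in> dom (adj A)" "the (adj A (c *\<^sub>C f)) = c *\<^sub>C the (adj A f)"
proof -
  have *: "cinner (the (A u)) (c *\<^sub>C f) = cinner u (c *\<^sub>C the (adj A f))" if "u \<in> dom A" for u
    using that assms by (simp add: adjD cinner_scaleC_right del: domIff)
  show "c *\<^sub>C f \<in> dom (adj A)" "the (adj A (c *\<^sub>C f)) = c *\<^sub>C the (adj A f)"
    by (rule adjI[OF assms(1)], erule *)+
qed

lemma adj_diff:
  assumes "densely_defined A" "f \<in> dom (adj A)" "g \<in> dom (adj A)"
  shows "f - g \<in> dom (adj A)" "the (adj A (f - g)) = the (adj A f) - the (adj A g)"
proof -
  have *: "cinner (the (A u)) (f - g) = cinner u (the (adj A f) - the (adj A g))" if "u \<in> dom A" for u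
    using that assms by (simp add: adjD cinner_diff_right del: domIff)
  show "f - g \<in> dom (adj A)" "the (adj A (f - g)) = the (adj A f) - the (adj A g)"
    by (rule adjI[OF assms(1)], erule *)+
qed

section \<open>Boundary triplets\<close>

locale dense_symmetric_triplet =
  fixes A :: "'a::chilbert_space \<rightharpoonup> 'a" and \<Gamma>\<^sub>0 \<Gamma>\<^sub>1 :: "'a \<Rightarrow> 'b::chilbert_space"
  assumes dense: "densely_defined A" and symmetric: "symmetric_op A"
    and triplet: "boundary_triplet A \<Gamma>\<^sub>0 \<Gamma>\<^sub>1"
begin

abbreviation "D \<equiv> dom (adj A)"

abbreviation S :: "'a \<Rightarrow> 'a"
  where "S f \<equiv> the (adj A f)"

text \<open>The domain of \<open>A\<^sub>0\<close>. Since \<open>A\<^sub>0\<close> acts as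
  \<open>S\<close> there, its properties are stated for \<open>S\<close> on this set instead of for
  the partial map.\<close>

definition D\<^sub>0 :: "'a set"
  where "D\<^sub>0 = {f \<in> D. \<Gamma>\<^sub>0 f = 0}"

lemmas S_add = adj_add[OF dense] and S_scaleC = adj_scaleC[OF dense] and S_diff = adj_diff[OF dense]

lemma green:
  assumes "f \<in> D" "g \<in> D"
  shows "cinner (S f) g - cinner f (S g) = cinner (\<Gamma>\<^sub>1 f) (\<Gamma>\<^sub>0 g) - cinner (\<Gamma>\<^sub>0 f) (\<Gamma>\<^sub>1 g)"
  using triplet assms unfolding boundary_triplet_def by blast

lemma boundary_values:
  obtains f where "f \<in> D" "\<Gamma>\<^sub>0 f = a" "\<Gamma>\<^sub>1 f = b"
proof -
  have "(b, a) \<in> (\<lambda>f. (\<Gamma>\<^sub>1 f, \<Gamma>\<^sub>0 f)) ` D"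
    using triplet unfolding boundary_triplet_def by simp
  then show ?thesis
    using that by auto
qed

lemma linear_\<Gamma>: "linear_on_set D \<Gamma>\<^sub>0" "linear_on_set D \<Gamma>\<^sub>1"
  using triplet unfolding boundary_triplet_def by (simp_all only:)

lemma
  assumes "f \<in> D"
  shows \<Gamma>\<^sub>0_scaleC: "\<Gamma>\<^sub>0 (c *\<^sub>C f) = c *\<^sub>C \<Gamma>\<^sub>0 f" and \<Gamma>\<^sub>1_scaleC: "\<Gamma>\<^sub>1 (c *\<^sub>C f) = c *\<^sub>C \<Gamma>\<^sub>1 f"
  using linear_\<Gamma> assms unfolding linear_on_set_def by (simp_all only:)

lemma
  assumes "f \<in> D" "g \<in> D"
  shows \<Gamma>\<^sub>0_add: "\<Gamma>\<^sub>0 (f + g) = \<Gamma>\<^sub>0 f + \<Gamma>\<^sub>0 g" and \<Gamma>\<^sub>1_add: "\<Gamma>\<^sub>1 (f + g) = \<Gamma>\<^sub>1 f + \<Gamma>\<^sub>1 g"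
  using linear_\<Gamma> assms unfolding linear_on_set_def by (simp_all only:)

lemma
  assumes "f \<in> D" "g \<in> D"
  shows \<Gamma>\<^sub>0_diff: "\<Gamma>\<^sub>0 (f - g) = \<Gamma>\<^sub>0 f - \<Gamma>\<^sub>0 g" and \<Gamma>\<^sub>1_diff: "\<Gamma>\<^sub>1 (f - g) = \<Gamma>\<^sub>1 f - \<Gamma>\<^sub>1 g"
  using \<Gamma>\<^sub>0_add[OF S_diff(1)[OF assms] assms(2)] \<Gamma>\<^sub>1_add[OF S_diff(1)[OF assms] assms(2)]
  by (simp_all only: diff_add_cancel eq_diff_eq)

lemma D\<^sub>0_add: "f \<in> D\<^sub>0 \<Longrightarrow> g \<in> D\<^sub>0 \<Longrightarrow> f + g \<in> D\<^sub>0"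
  and D\<^sub>0_diff: "f \<in> D\<^sub>0 \<Longrightarrow> g \<in> D\<^sub>0 \<Longrightarrow> f - g \<in> D\<^sub>0"
  and D\<^sub>0_scaleC: "f \<in> D\<^sub>0 \<Longrightarrow> c *\<^sub>C f \<in> D\<^sub>0"
  and D\<^sub>0_imp_D: "f \<in> D\<^sub>0 \<Longrightarrow> f \<in> D"
  unfolding D\<^sub>0_def
  by (simp_all del: domIff add: S_add(1) S_diff(1) S_scaleC(1) \<Gamma>\<^sub>0_add \<Gamma>\<^sub>0_diff \<Gamma>\<^sub>0_scaleC)

section \<open>Self-adjointness of \<open>A\<^sub>0\<close>\<close>

text \<open>By symmetry the adjoint extends \<open>A\<close>, so the left side of Green's identity
  vanishes for \<open>f\<close> in \<open>dom A\<close> and any \<open>g\<close> in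
  \<open>D\<close>. A \<open>g\<close> with boundary values \<open>0\<close> and
  \<open>\<Gamma>\<^sub>0 f\<close> leaves only the square of the norm of
  \<open>\<Gamma>\<^sub>0 f\<close>.\<close>

lemma dom_subset_D\<^sub>0:
  assumes "f \<in> dom A"
  shows "f \<in> D\<^sub>0" "S f = the (A f)"
proof -
  have *: "cinner (the (A g)) f = cinner g (the (A f))" if "g \<in> dom A" for g
    using symmetric that assms unfolding symmetric_op_def by blast
  have f: "f \<in> D" and Sf: "S f = the (A f)"
    using adjI[OF dense *] by blast+
  obtain g where g: "g \<in> D" "\<Gamma>\<^sub>0 g = 0" "\<Gamma>\<^sub>1 g = \<Gamma>\<^sub>0 f"
    by (rule boundary_values)
  have "cinner (\<Gamma>\<^sub>0 f) (\<Gamma>\<^sub>0 f) = 0"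
    using green[OF f g(1)] adjD[OF dense g(1) assms] Sf g by simp
  then show "f \<in> D\<^sub>0"
    using f by (simp add: D\<^sub>0_def cinner_self)
qed (use adjI[OF dense] symmetric assms in \<open>simp add: symmetric_op_def\<close>)

lemma symmetric_D\<^sub>0:
  assumes "f \<in> D\<^sub>0" "g \<in> D\<^sub>0"
  shows "cinner (S f) g = cinner f (S g)"
  using green[of f g] assms by (simp add: D\<^sub>0_def)

text \<open>The adjoint of \<open>A\<^sub>0\<close> is no larger than \<open>A\<^sub>0\<close>.
  Testing on \<open>dom A\<close> puts \<open>g\<close> into \<open>D\<close>; a \<open>u\<close> in
  \<open>D\<^sub>0\<close> with \<open>\<Gamma>\<^sub>1 u = \<Gamma>\<^sub>0 g\<close> then forces
  \<open>\<Gamma>\<^sub>0 g = 0\<close>.\<close>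

lemma selfadjoint_D\<^sub>0:
  assumes "\<And>u. u \<in> D\<^sub>0 \<Longrightarrow> cinner (S u) g = cinner u h"
  shows "g \<in> D\<^sub>0" "S g = h"
proof -
  have *: "cinner (the (A f)) g = cinner f h" if "f \<in> dom A" for f
    using assms[OF dom_subset_D\<^sub>0(1)[OF that]] dom_subset_D\<^sub>0(2)[OF that] by simp
  have g: "g \<in> D" and Sg: "S g = h"
    using adjI[OF dense *] by blast+
  obtain u where u: "u \<in> D" "\<Gamma>\<^sub>0 u = 0" "\<Gamma>\<^sub>1 u = \<Gamma>\<^sub>0 g"
    by (rule boundary_values)
  have "cinner (\<Gamma>\<^sub>0 g) (\<Gamma>\<^sub>0 g) = 0"
    using green[OF u(1) g] assms[of u] Sg u by (simp add: D\<^sub>0_def)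
  then show "g \<in> D\<^sub>0"
    using g by (simp add: D\<^sub>0_def cinner_self)
  show "S g = h"
    by (rule Sg)
qed

section \<open>Non-real points are in the resolvent set of \<open>A\<^sub>0\<close>\<close>

text \<open>Since \<open>cinner (S f) f\<close> is real, the imaginary part of
  \<open>cinner (S f - z *\<^sub>C f) f\<close> comes from \<open>z\<close> alone. Injectivity,
  closed range and the resolvent bound all rest on this estimate.\<close>

lemma norm_S_minus_ge:
  assumes "f \<in> D\<^sub>0"
  shows "\<bar>Im z\<bar> * norm f \<le> norm (S f - z *\<^sub>C f)"
proof (cases "f = 0")
  case False
  have "Im (cinner (S f) f) = 0"
    using symmetric_D\<^sub>0[OF assms assms] cinner_commute[of f "S f"]
    by (metis Reals_cnj_iff complex_is_Real_iff)
  then have "\<bar>Im z\<bar> * (norm f)\<^sup>2 = \<bar>Im (cinner (S f - z *\<^sub>C f) f)\<bar>"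
    by (simp add: cinner_diff_left cinner_scaleC_left cinner_self abs_mult del: of_real_power)
  also have "\<dots> \<le> norm (S f - z *\<^sub>C f) * norm f"
    using abs_Im_le_cmod norm_cinner_le order_trans by blast
  finally show ?thesis
    using False by (simp add: power2_eq_square)
qed simp

lemma S_minus_linear:
  assumes "f \<in> D" "g \<in> D"
  shows "S (f + g) - z *\<^sub>C (f + g) = (S f - z *\<^sub>C f) + (S g - z *\<^sub>C g)"
    and "S (f - g) - z *\<^sub>C (f - g) = (S f - z *\<^sub>C f) - (S g - z *\<^sub>C g)"
    and "S (c *\<^sub>C f) - z *\<^sub>C (c *\<^sub>C f) = c *\<^sub>C (S f - z *\<^sub>C f)"
  using assms
  by (simp_all del: domIff add: S_add S_diff S_scaleC complex_vector.scale_right_distrib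
      complex_vector.scale_right_diff_distrib complex_vector.scale_left_commute[of z c])

lemma S_minus_inj:
  assumes "Im z \<noteq> 0" "f \<in> D\<^sub>0" "g \<in> D\<^sub>0" "S f - z *\<^sub>C f = S g - z *\<^sub>C g"
  shows "f = g"
  using norm_S_minus_ge[OF D\<^sub>0_diff[OF assms(2,3)], of z] assms
  by (simp add: S_minus_linear D\<^sub>0_imp_D mult_le_0_iff)

text \<open>The lower bound makes preimages of a convergent sequence Cauchy, and self-adjointness
  keeps their limit in \<open>D\<^sub>0\<close>.\<close>

lemma closed_range_S_minus:
  assumes "Im z \<noteq> 0"
  shows "closed ((\<lambda>f. S f - z *\<^sub>C f) ` D\<^sub>0)"
  unfolding closed_sequential_limits
proof (intro allI impI, elim conjE)
  fix u l assume "\<forall>n. u n \<in> (\<lambda>f. S f - z *\<^sub>C f) ` D\<^sub>0" and ul: "u \<longlonglongrightarrow> l"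
  then have "\<forall>n. \<exists>f. f \<in> D\<^sub>0 \<and> u n = S f - z *\<^sub>C f"
    by blast
  then obtain f where f: "\<And>n. f n \<in> D\<^sub>0" "\<And>n. u n = S (f n) - z *\<^sub>C f n"
    by metis
  have dist_f: "dist (f m) (f n) \<le> dist (u m) (u n) / \<bar>Im z\<bar>" for m n
  proof -
    have "norm (u m - u n) = norm (S (f m - f n) - z *\<^sub>C (f m - f n))"
      by (simp only: f(2) S_minus_linear(2)[OF D\<^sub>0_imp_D[OF f(1)] D\<^sub>0_imp_D[OF f(1)]])
    then show ?thesis
      using norm_S_minus_ge[OF D\<^sub>0_diff[OF f(1) f(1)], of z m n] assms
      by (simp add: dist_norm pos_le_divide_eq mult.commute)
  qed
  have "Cauchy f"
  proof (rule metric_CauchyI)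
    fix e :: real assume "e > 0"
    then obtain M where M: "\<And>m n. m \<ge> M \<Longrightarrow> n \<ge> M \<Longrightarrow> dist (u m) (u n) < e * \<bar>Im z\<bar>"
      using metric_CauchyD[OF LIMSEQ_imp_Cauchy[OF ul], of "e * \<bar>Im z\<bar>"] assms by auto
    then have "dist (f m) (f n) < e" if "m \<ge> M" "n \<ge> M" for m n
    proof -
      have "dist (u m) (u n) / \<bar>Im z\<bar> < e"
        using M[OF that] assms by (simp add: pos_divide_less_eq)
      then show ?thesis
        using dist_f[of m n] by linarith
    qed
    then show "\<exists>M. \<forall>m\<ge>M. \<forall>n\<ge>M. dist (f m) (f n) < e"
      by blast
  qed
  then obtain g where fg: "f \<longlonglongrightarrow> g"
    using Cauchy_convergent convergent_def by blast
  have Sf: "(\<lambda>n. S (f n)) \<longlonglongrightarrow> l + z *\<^sub>C g"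
    using tendsto_add[OF ul tendsto_scaleC_right[OF fg, of z]] f by simp
  \<comment> \<open>Passing to the limit in the symmetry relation for \<open>v\<close> and
    \<open>f n\<close>.\<close>
  have *: "cinner (S v) g = cinner v (l + z *\<^sub>C g)" if "v \<in> D\<^sub>0" for v
    using tendsto_cinner_right[OF fg, of "S v"] tendsto_cinner_right[OF Sf, of v]
    by (simp add: symmetric_D\<^sub>0[OF that f(1)] LIMSEQ_unique)
  have "g \<in> D\<^sub>0" "S g = l + z *\<^sub>C g"
    by (rule selfadjoint_D\<^sub>0, erule *)+
  then show "l \<in> (\<lambda>f. S f - z *\<^sub>C f) ` D\<^sub>0"
    by force
qed

text \<open>The range is closed, and a vector orthogonal to it is an eigenvector of the self-adjoint
  operator \<open>A\<^sub>0\<close> for the non-real eigenvalue \<open>cnj z\<close>.\<close>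

lemma range_S_minus:
  assumes "Im z \<noteq> 0"
  shows "(\<lambda>f. S f - z *\<^sub>C f) ` D\<^sub>0 = UNIV"
proof (rule closed_subspace_eq_UNIV[OF closed_range_S_minus[OF assms]])
  let ?R = "(\<lambda>f. S f - z *\<^sub>C f) ` D\<^sub>0"
  have "0 \<in> D\<^sub>0" "S 0 = 0"
    using selfadjoint_D\<^sub>0[of 0 0] by simp_all
  then have "0 \<in> ?R"
    by (intro image_eqI[of _ _ 0]) simp_all
  moreover have "x + y \<in> ?R" if xy: "x \<in> ?R" "y \<in> ?R" for x y
  proof -
    obtain f g where "x = S f - z *\<^sub>C f" "f \<in> D\<^sub>0" "y = S g - z *\<^sub>C g" "g \<in> D\<^sub>0"
      using xy by (elim imageE)
    then show ?thesis
      by (intro image_eqI[of _ _ "f + g"] D\<^sub>0_add)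
        (simp_all only: S_minus_linear(1)[OF D\<^sub>0_imp_D D\<^sub>0_imp_D])
  qed
  moreover have "c *\<^sub>C x \<in> ?R" if x: "x \<in> ?R" for c x
  proof -
    obtain f where "x = S f - z *\<^sub>C f" "f \<in> D\<^sub>0"
      using x by (elim imageE)
    then show ?thesis
      by (intro image_eqI[of _ _ "c *\<^sub>C f"] D\<^sub>0_scaleC)
        (simp_all only: S_minus_linear(3)[OF D\<^sub>0_imp_D D\<^sub>0_imp_D])
  qed
  ultimately show "complex_vector.subspace ?R"
    unfolding complex_vector.subspace_def by simp
next
  fix v assume v: "\<And>u. u \<in> (\<lambda>f. S f - z *\<^sub>C f) ` D\<^sub>0 \<Longrightarrow> cinner u v = 0"
  have *: "cinner (S u) v = cinner u (cnj z *\<^sub>C v)" if "u \<in> D\<^sub>0" for u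
    using v[OF imageI, OF that] by (simp add: cinner_simps)
  have "v \<in> D\<^sub>0" "S v = cnj z *\<^sub>C v"
    by (rule selfadjoint_D\<^sub>0, erule *)+
  then show "v = 0"
    using norm_S_minus_ge[of v "cnj z"] assms by (simp add: mult_le_0_iff)
qed

text \<open>Ensures that off the real axis \<open>weyl_function\<close> is given by its description
  and not by \<open>undefined\<close>.\<close>

lemma nonreal_in_resolvent_set:
  assumes "Im z \<noteq> 0"
  shows "z \<in> resolvent_set (op_A0 A \<Gamma>\<^sub>0)"
proof -
  have dom: "dom (op_A0 A \<Gamma>\<^sub>0) = D\<^sub>0"
    by (auto simp: op_A0_def D\<^sub>0_def)
  have val: "the (op_A0 A \<Gamma>\<^sub>0 f) = S f" if "f \<in> D\<^sub>0" for f
    using that by (simp add: op_A0_def D\<^sub>0_def)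
  have "bij_betw (\<lambda>f. S f - z *\<^sub>C f) D\<^sub>0 UNIV"
    using S_minus_inj[OF assms] range_S_minus[OF assms] by (auto simp: bij_betw_def inj_on_def)
  moreover have "norm f \<le> 1 / \<bar>Im z\<bar> * norm (S f - z *\<^sub>C f)" if "f \<in> D\<^sub>0" for f
    using norm_S_minus_ge[OF that, of z] assms by (simp add: field_simps)
  ultimately show ?thesis
    unfolding resolvent_set_def dom
    by (intro CollectI conjI exI[of _ "1 / \<bar>Im z\<bar>"]) (simp_all add: val cong: bij_betw_cong)
qed

section \<open>The resolvent of \<open>A\<^sub>0\<close>\<close>

definition res :: "complex \<Rightarrow> 'a \<Rightarrow> 'a"
  where "res z u = (THE f. f \<in> D\<^sub>0 \<and> S f - z *\<^sub>C f = u)"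

lemma res_eqI:
  assumes "Im z \<noteq> 0" "f \<in> D\<^sub>0" "S f - z *\<^sub>C f = u"
  shows "res z u = f"
  unfolding res_def
proof (rule the_equality)
  fix g assume "g \<in> D\<^sub>0 \<and> S g - z *\<^sub>C g = u"
  then have "g \<in> D\<^sub>0" "S g - z *\<^sub>C g = S f - z *\<^sub>C f"
    by (simp_all only: assms(3))
  then show "g = f"
    using S_minus_inj[OF assms(1)] assms(2) by (simp only:)
qed (use assms in simp)

lemma
  assumes "Im z \<noteq> 0"
  shows res_D\<^sub>0: "res z u \<in> D\<^sub>0" and S_res: "S (res z u) - z *\<^sub>C res z u = u"
proof -
  have "u \<in> (\<lambda>f. S f - z *\<^sub>C f) ` D\<^sub>0"
    by (simp only: range_S_minus[OF assms] UNIV_I)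
  then obtain f where f: "u = S f - z *\<^sub>C f" "f \<in> D\<^sub>0"
    by (rule imageE)
  show "res z u \<in> D\<^sub>0" "S (res z u) - z *\<^sub>C res z u = u"
    unfolding res_eqI[OF assms f(2) f(1)[symmetric]] using f by (auto simp only:)
qed

lemma norm_res_le:
  assumes "Im z \<noteq> 0"
  shows "norm (res z u) \<le> norm u / \<bar>Im z\<bar>"
  using norm_S_minus_ge[OF res_D\<^sub>0[OF assms], of z u] assms
  unfolding S_res[OF assms] by (simp add: pos_le_divide_eq mult.commute)

lemma resolvent_identity:
  assumes "Im w \<noteq> 0" "Im z \<noteq> 0"
  shows "res w u - res z u = (w - z) *\<^sub>C res z (res w u)"
proof -
  let ?f = "res w u - (w - z) *\<^sub>C res z (res w u)"
  note D = D\<^sub>0_imp_D[OF res_D\<^sub>0[OF assms(1)]] D\<^sub>0_imp_D[OF res_D\<^sub>0[OF assms(2)]]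
  \<comment> \<open>\<open>?f\<close> lies in \<open>D\<^sub>0\<close>, so once it is shown to be
    mapped to \<open>u\<close>, uniqueness identifies it with \<open>res z u\<close>.\<close>
  have "S ?f - z *\<^sub>C ?f = (S (res w u) - z *\<^sub>C res w u) - (w - z) *\<^sub>C res w u"
    by (simp only: S_minus_linear(2)[OF D(1) S_scaleC(1)[OF D(2)]] S_minus_linear(3)[OF D(2) D(2)]
        S_res[OF assms(2)])
  also have "\<dots> = S (res w u) - w *\<^sub>C res w u"
    by (simp add: complex_vector.scale_left_diff_distrib)
  finally have "res z u = ?f"
    using assms by (intro res_eqI D\<^sub>0_diff D\<^sub>0_scaleC res_D\<^sub>0) (simp_all add: S_res)
  then show ?thesis
    by simp
qed

section \<open>Eigenvectors with prescribed boundary value\<close>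

text \<open>The \<open>\<gamma>\<close>-field of the boundary triplet.\<close>

definition gam :: "complex \<Rightarrow> 'b \<Rightarrow> 'a"
  where "gam z a = (THE f. f \<in> eigenspace (adj A) z \<and> \<Gamma>\<^sub>0 f = a)"

text \<open>Two solutions differ by an element of \<open>D\<^sub>0\<close> annihilated by
  \<open>S - z\<close>, which is zero for non-real \<open>z\<close>.\<close>

lemma gam_eqI:
  assumes "Im z \<noteq> 0" "f \<in> eigenspace (adj A) z" "\<Gamma>\<^sub>0 f = a"
  shows "gam z a = f"
  unfolding gam_def
proof (rule the_equality)
  fix g assume g: "g \<in> eigenspace (adj A) z \<and> \<Gamma>\<^sub>0 g = a"
  then have *: "f \<in> D" "g \<in> D" "S f - z *\<^sub>C f = 0" "S g - z *\<^sub>C g = 0"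
    using assms by (auto simp: eigenspace_def)
  then have "g - f \<in> D\<^sub>0"
    using assms g by (simp del: domIff add: D\<^sub>0_def S_diff \<Gamma>\<^sub>0_diff)
  then show "g = f"
    using norm_S_minus_ge[of "g - f" z] S_minus_linear(2)[OF *(2,1), of z] * assms(1)
    by (simp add: mult_le_0_iff)
qed (use assms in simp)

lemma
  assumes "Im z \<noteq> 0"
  shows gam_D: "gam z a \<in> D" and S_gam: "S (gam z a) = z *\<^sub>C gam z a"
    and \<Gamma>\<^sub>0_gam: "\<Gamma>\<^sub>0 (gam z a) = a"
proof -
  obtain g where g: "g \<in> D" "\<Gamma>\<^sub>0 g = a"
    by (rule boundary_values)
  \<comment> \<open>Subtracting the element of \<open>D\<^sub>0\<close> with the same image under
    \<open>S - z\<close> turns \<open>g\<close> into an eigenvector without changing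
    \<open>\<Gamma>\<^sub>0 g\<close>.\<close>
  let ?r = "res z (S g - z *\<^sub>C g)"
  have r: "?r \<in> D\<^sub>0" "S ?r - z *\<^sub>C ?r = S g - z *\<^sub>C g"
    by (rule res_D\<^sub>0[OF assms], rule S_res[OF assms])
  have f: "g - ?r \<in> eigenspace (adj A) z" "\<Gamma>\<^sub>0 (g - ?r) = a"
    unfolding eigenspace_def using g r S_minus_linear(2)[OF g(1) D\<^sub>0_imp_D[OF r(1)], of z]
    by (simp_all del: domIff add: S_diff(1) \<Gamma>\<^sub>0_diff D\<^sub>0_imp_D) (simp add: D\<^sub>0_def)
  show "gam z a \<in> D" "S (gam z a) = z *\<^sub>C gam z a" "\<Gamma>\<^sub>0 (gam z a) = a"
    using f gam_eqI[OF assms f] by (auto simp: eigenspace_def)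
qed

text \<open>The correction \<open>(w - z) *\<^sub>C res w (gam z a)\<close> moves the eigenvalue
  from \<open>z\<close> to \<open>w\<close>, and lying in \<open>D\<^sub>0\<close> it preserves the
  boundary value \<open>a\<close>.\<close>

lemma gam_diff:
  assumes "Im w \<noteq> 0" "Im z \<noteq> 0"
  shows "gam w a - gam z a = (w - z) *\<^sub>C res w (gam z a)"
proof -
  let ?r = "res w (gam z a)" and ?f = "gam z a + (w - z) *\<^sub>C res w (gam z a)"
  note D = gam_D[OF assms(2)] D\<^sub>0_imp_D[OF res_D\<^sub>0[OF assms(1)]]
  have "S ?f - w *\<^sub>C ?f = (S (gam z a) - w *\<^sub>C gam z a) + (w - z) *\<^sub>C gam z a"
    by (simp only: S_minus_linear(1)[OF D(1) S_scaleC(1)[OF D(2)]] S_minus_linear(3)[OF D(2) D(2)]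
        S_res[OF assms(1)])
  then have "S ?f - w *\<^sub>C ?f = 0"
    by (simp add: S_gam assms complex_vector.scale_left_diff_distrib)
  moreover have "?f \<in> D" "\<Gamma>\<^sub>0 ?f = a"
    using D res_D\<^sub>0[OF assms(1), of "gam z a"] assms
    by (simp_all del: domIff add: S_add(1) S_scaleC(1) \<Gamma>\<^sub>0_add \<Gamma>\<^sub>0_scaleC \<Gamma>\<^sub>0_gam) (simp add: D\<^sub>0_def)
  ultimately have "gam w a = ?f"
    by (intro gam_eqI[OF assms(1)]) (auto simp: eigenspace_def)
  then show ?thesis
    by simp
qed

section \<open>The Weyl function off the real axis\<close>

text \<open>A pointwise form of the Weyl function, available before boundedness is known.\<close>

definition M :: "complex \<Rightarrow> 'b \<Rightarrow> 'b"
  where "M z a = \<Gamma>\<^sub>1 (gam z a)"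

text \<open>Used twice: with \<open>z = cnj w\<close> the right side vanishes and gives the adjoint;
  with \<open>w = z\<close> and \<open>a = b\<close> it gives the imaginary part.\<close>

lemma cinner_M:
  assumes "Im w \<noteq> 0" "Im z \<noteq> 0"
  shows "cinner (M w a) b - cinner a (M z b) = (w - cnj z) * cinner (gam w a) (gam z b)"
  using green[OF gam_D[OF assms(1)] gam_D[OF assms(2)], of a b]
  by (simp add: S_gam \<Gamma>\<^sub>0_gam assms cinner_scaleC_left cinner_scaleC_right left_diff_distrib
      flip: M_def)

lemma M_adjoint:
  assumes "Im z \<noteq> 0"
  shows "cinner (M z a) b = cinner a (M (cnj z) b)"
  using cinner_M[of z "cnj z"] assms by simp

text \<open>In Green's identity for \<open>gam z a\<close> and \<open>res (cnj z) u\<close> the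
  eigenvalue terms cancel, and \<open>\<Gamma>\<^sub>0\<close> of the resolvent vector is
  zero.\<close>

lemma gam_adjoint:
  assumes "Im z \<noteq> 0"
  shows "cinner (gam z a) u = cinner a (\<Gamma>\<^sub>1 (res (cnj z) u))"
proof -
  let ?r = "res (cnj z) u"
  have z: "Im (cnj z) \<noteq> 0"
    using assms by simp
  have r: "?r \<in> D" "\<Gamma>\<^sub>0 ?r = 0" "S ?r = u + cnj z *\<^sub>C ?r"
    using res_D\<^sub>0[OF z, of u] S_res[OF z, of u] by (auto simp: D\<^sub>0_def algebra_simps)
  show ?thesis
    using green[OF gam_D[OF assms] r(1), of a] r(2,3)
    by (simp add: S_gam \<Gamma>\<^sub>0_gam assms cinner_simps)
qed

lemma bounded_op_M: "Im z \<noteq> 0 \<Longrightarrow> bounded_op (M z)"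
  by (rule adjoint_pair_bounded) (rule M_adjoint)

lemma bounded_op_gam: "Im z \<noteq> 0 \<Longrightarrow> bounded_op (gam z)"
  by (rule adjoint_pair_bounded) (rule gam_adjoint)

lemma bounded_op_\<Gamma>\<^sub>1_res:
  assumes "Im z \<noteq> 0"
  shows "bounded_op (\<lambda>u. \<Gamma>\<^sub>1 (res z u))"
proof (rule adjoint_pair_bounded)
  fix u b
  have "cinner (gam (cnj z) b) u = cinner b (\<Gamma>\<^sub>1 (res z u))"
    using gam_adjoint[of "cnj z" b u] assms by simp
  then show "cinner (\<Gamma>\<^sub>1 (res z u)) b = cinner u (gam (cnj z) b)"
    using cinner_commute[of u "gam (cnj z) b"] cinner_commute[of "\<Gamma>\<^sub>1 (res z u)" b] by simp
qed

text \<open>Every \<open>a\<close> is the boundary value of the eigenvector \<open>gam z a\<close>,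
  so the defining relation fixes \<open>T\<close> everywhere; \<open>M z\<close> qualifies because
  it is bounded.\<close>

lemma weyl_function_eq_M:
  assumes "Im z \<noteq> 0"
  shows "weyl_function A \<Gamma>\<^sub>0 \<Gamma>\<^sub>1 z = M z"
proof -
  have M: "M z (\<Gamma>\<^sub>0 f) = \<Gamma>\<^sub>1 f" if "f \<in> eigenspace (adj A) z" for f
    unfolding M_def using gam_eqI[OF assms that] by simp
  have "T = M z" if "\<forall>f\<in>eigenspace (adj A) z. T (\<Gamma>\<^sub>0 f) = \<Gamma>\<^sub>1 f" for T
  proof
    fix a
    have "gam z a \<in> eigenspace (adj A) z"
      using gam_D S_gam assms by (simp del: domIff add: eigenspace_def)
    with that have "T (\<Gamma>\<^sub>0 (gam z a)) = \<Gamma>\<^sub>1 (gam z a)"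
      by (rule bspec)
    then show "T a = M z a"
      by (simp only: \<Gamma>\<^sub>0_gam[OF assms] M_def)
  qed
  then have "(THE T. bounded_op T \<and> (\<forall>f\<in>eigenspace (adj A) z. T (\<Gamma>\<^sub>0 f) = \<Gamma>\<^sub>1 f)) = M z"
    using M bounded_op_M[OF assms] by (intro the_equality) auto
  then show ?thesis
    using nonreal_in_resolvent_set[OF assms] by (simp add: weyl_function_def)
qed

lemma op_nonneg_Im_M:
  assumes "Im z > 0"
  shows "op_nonneg (op_Im (M z))"
  unfolding op_nonneg_def
proof
  fix a
  have z: "Im z \<noteq> 0"
    using assms by simp
  have "op_adjoint (M z) a = M (cnj z) a"
    unfolding op_adjoint_def
  proof (rule the_equality)
    show "h = M (cnj z) a" if "\<forall>x. cinner (M z x) a = cinner x h" for h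
      by (rule cinner_extensionality) (simp add: that[rule_format] flip: M_adjoint[OF z])
  qed (simp add: M_adjoint[OF z])
  then have "cinner (op_Im (M z) a) a = (1 / (2 * \<i>)) * (cinner (M z a) a - cinner (M (cnj z) a) a)"
    by (simp only: op_Im_def cinner_scaleC_left cinner_diff_left)
  also have "cinner (M (cnj z) a) a = cinner a (M z a)"
    using M_adjoint[of "cnj z"] z by simp
  also have "cinner (M z a) a - cinner a (M z a) = (z - cnj z) * complex_of_real ((norm (gam z a))\<^sup>2)"
    by (simp only: cinner_M[OF z z] cinner_self)
  \<comment> \<open>Here \<open>z - cnj z\<close> equals \<open>2 * \<i> * Im z\<close>.\<close>
  also have "(1 / (2 * \<i>)) * \<dots> = complex_of_real (Im z * (norm (gam z a))\<^sup>2)"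
    by (simp add: complex_diff_cnj mult_ac)
  finally show "cinner (op_Im (M z) a) a \<in> \<real>\<^sub>\<ge>\<^sub>0"
    using assms by simp
qed

section \<open>Holomorphy of the Weyl function\<close>

text \<open>By \<open>gam_diff\<close> the quotient is
  \<open>\<Gamma>\<^sub>1 (res w (gam z a))\<close>; the resolvent identity then extracts a second
  factor \<open>w - z\<close> from its distance to the derivative.\<close>

lemma M_difference_quotient:
  assumes "Im w \<noteq> 0" "Im z \<noteq> 0" "w \<noteq> z"
  shows "(1 / (w - z)) *\<^sub>C (M w a - M z a) - \<Gamma>\<^sub>1 (res z (gam z a)) =
    (w - z) *\<^sub>C \<Gamma>\<^sub>1 (res z (res w (gam z a)))"
proof -
  note D = D\<^sub>0_imp_D[OF res_D\<^sub>0[OF assms(1)]] D\<^sub>0_imp_D[OF res_D\<^sub>0[OF assms(2)]]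
  have "M w a - M z a = \<Gamma>\<^sub>1 (gam w a - gam z a)"
    by (simp add: M_def \<Gamma>\<^sub>1_diff gam_D assms del: domIff)
  also have "\<dots> = (w - z) *\<^sub>C \<Gamma>\<^sub>1 (res w (gam z a))"
    by (simp only: gam_diff[OF assms(1,2)] \<Gamma>\<^sub>1_scaleC[OF D(1)])
  finally have "(1 / (w - z)) *\<^sub>C (M w a - M z a) = \<Gamma>\<^sub>1 (res w (gam z a))"
    using assms(3) by (simp add: scaleC_scaleC)
  then show ?thesis
    by (simp only: resolvent_identity[OF assms(1,2)] \<Gamma>\<^sub>1_scaleC[OF D(2)] flip: \<Gamma>\<^sub>1_diff[OF D])
qed

lemma op_holomorphic_on_weyl_function:
  "op_holomorphic_on (weyl_function A \<Gamma>\<^sub>0 \<Gamma>\<^sub>1) upper_half_plane"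
  unfolding op_holomorphic_on_def
proof (intro conjI ballI)
  fix z assume "z \<in> upper_half_plane"
  then have z: "Im z > 0" "Im z \<noteq> 0"
    by (auto simp: upper_half_plane_def)
  show "bounded_op (weyl_function A \<Gamma>\<^sub>0 \<Gamma>\<^sub>1 z)"
    using z by (simp add: weyl_function_eq_M bounded_op_M)
  let ?B = "\<lambda>u. \<Gamma>\<^sub>1 (res z u)"
  note B = bounded_op_\<Gamma>\<^sub>1_res[OF z(2)] and G = bounded_op_gam[OF z(2)]
  have D: "bounded_op (\<lambda>a. ?B (gam z a))"
    using B G by (auto simp: bounded_op_def intro: bounded_linear_compose[of ?B])
  obtain K where K: "K \<ge> 0" "\<And>u. norm (?B u) \<le> norm u * K"
    using B bounded_linear.nonneg_bounded unfolding bounded_op_def by blast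
  obtain L where L: "L \<ge> 0" "\<And>a. norm (gam z a) \<le> norm a * L"
    using G bounded_linear.nonneg_bounded unfolding bounded_op_def by blast
  let ?Q = "\<lambda>w a. (1 / (w - z)) *\<^sub>C (M w a - M z a) - ?B (gam z a)"
  \<comment> \<open>\<open>K\<close> and \<open>L\<close> depend on \<open>z\<close> only. The sole
    other dependence on \<open>w\<close> is \<open>1 / Im w\<close>, which stays bounded near
    \<open>z\<close>.\<close>
  have bound: "norm (onorm (?Q w)) \<le> cmod (w - z) * (L / Im w * K)" if w: "Im w > 0" "w \<noteq> z" for w
  proof -
    have w': "Im w \<noteq> 0"
      using w by simp
    have "bounded_linear (?Q w)"
      using D bounded_op_M[OF w'] bounded_op_M[OF z(2)] unfolding bounded_op_def
      by (intro bounded_linear_sub bounded_linear_compose[OF bounded_linear_scaleC_right]) auto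
    then have "onorm (?Q w) \<ge> 0"
      by (rule onorm_pos_le)
    moreover have "onorm (?Q w) \<le> cmod (w - z) * (L / Im w * K)"
    proof (rule onorm_bound)
      fix a
      have "norm (res w (gam z a)) \<le> norm a * L / Im w"
        using norm_res_le[OF w', of "gam z a"] L(2)[of a] w(1)
        by (intro order_trans[OF norm_res_le[OF w']]) (simp add: divide_right_mono)
      then have "norm (?B (res w (gam z a))) \<le> norm a * L / Im w * K"
        using K by (meson mult_right_mono order_trans)
      then have "norm (?Q w a) \<le> cmod (w - z) * (norm a * L / Im w * K)"
        unfolding M_difference_quotient[OF w' z(2) w(2)] norm_scaleC
        by (intro mult_left_mono) auto
      then show "norm (?Q w a) \<le> cmod (w - z) * (L / Im w * K) * norm a"
        by (simp add: mult_ac)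
    qed (use K L w in simp)
    ultimately show ?thesis
      by simp
  qed
  have "((\<lambda>w. onorm (\<lambda>a. (1 / (w - z)) *\<^sub>C (weyl_function A \<Gamma>\<^sub>0 \<Gamma>\<^sub>1 w a - weyl_function A \<Gamma>\<^sub>0 \<Gamma>\<^sub>1 z a)
      - ?B (gam z a))) \<longlongrightarrow> 0) (at z within upper_half_plane)"
  proof (rule Lim_null_comparison)
    show "\<forall>\<^sub>F w in at z within upper_half_plane.
        norm (onorm (\<lambda>a. (1 / (w - z)) *\<^sub>C (weyl_function A \<Gamma>\<^sub>0 \<Gamma>\<^sub>1 w a - weyl_function A \<Gamma>\<^sub>0 \<Gamma>\<^sub>1 z a)
          - ?B (gam z a))) \<le> cmod (w - z) * (L / Im w * K)"
      unfolding eventually_at_filter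
      by (intro always_eventually allI impI)
        (use bound z in \<open>simp add: weyl_function_eq_M upper_half_plane_def\<close>)
    have "((\<lambda>w. cmod (w - z) * (L / Im w * K)) \<longlongrightarrow> cmod (z - z) * (L / Im z * K))
        (at z within upper_half_plane)"
      using z by (intro tendsto_intros) auto
    then show "((\<lambda>w. cmod (w - z) * (L / Im w * K)) \<longlongrightarrow> 0) (at z within upper_half_plane)"
      by simp
  qed
  with D show "\<exists>D. bounded_op D \<and>
      ((\<lambda>w. onorm (\<lambda>a. (1 / (w - z)) *\<^sub>C (weyl_function A \<Gamma>\<^sub>0 \<Gamma>\<^sub>1 w a - weyl_function A \<Gamma>\<^sub>0 \<Gamma>\<^sub>1 z a)
        - D a)) \<longlongrightarrow> 0) (at z within upper_half_plane)"
    by blast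
qed

end

theorem corollary3p5:
  fixes A :: "'a::chilbert_space \<rightharpoonup> 'a"
    and \<Gamma>\<^sub>0 \<Gamma>\<^sub>1 :: "'a \<Rightarrow> 'b::chilbert_space"
  assumes "separable_space (euclidean :: 'a topology)"
    and "linear_op A"
    and "closed_op A"
    and "densely_defined A"
    and "symmetric_op A"
    and "equal_deficiency_indices A"
    and "boundary_triplet A \<Gamma>\<^sub>0 \<Gamma>\<^sub>1"
  shows "class_R (weyl_function A \<Gamma>\<^sub>0 \<Gamma>\<^sub>1)"
proof -
  interpret dense_symmetric_triplet A \<Gamma>\<^sub>0 \<Gamma>\<^sub>1
    using assms by unfold_locales
  show ?thesis
    unfolding class_R_def
    using op_holomorphic_on_weyl_function op_nonneg_Im_M
    by (simp add: upper_half_plane_def weyl_function_eq_M)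
qed

end
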